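(* Let $\mathcal{K}(\mathbb{M}_2)\cong\mathbb{R}^6$ be the space of Killing $2$-tensors of the Minkowski plane with coordinates $(A,B,C,\alpha,\beta,\gamma)$, and let $G_M$, $R_0$, $S_1$, $S_2$ be as defined in the context. The set $S_1\setminus S_2$ is formed by $4$ connected components. Each pair of components symmetric with respect to the origin is linked by $R_0$ (i.e. $R_0$ maps one component of the pair onto the other), and thus two orbits of the action of $G_M$ are present in $S_1\setminus S_2$ (namely, each such pair of components forms an orbit).
   Context: In the Minkowski plane $\mathbb{M}_2$ with pseudo-Cartesian coordinates $(t,x)$ and metric $\mathbf{g}$ with contravariant components $\mathrm{diag}(1,-1)$, the general Killing $2$-tensor has contravariant components $K^{11}=A+2\alpha x+\gamma x^2$, $K^{12}=K^{21}=C+\alpha t+\beta x+\gamma tx$, $K^{22}=B+2\beta t+\gamma t^2$, with $A,B,C,\alpha,\beta,\gamma\in\mathbb{R}$. So the vector space $\mathcal{K}(\mathbb{M}_2)$ of Killing $2$-tensors is identified with $\mathbb{R}^6$ with coordinates $(A,B,C,\alpha,\beta,\gamma)$. With respect to $(\partial_A,\partial_B,\partial_C,\partial_\alpha,\partial_\beta,\partial_\gamma)$ define the vector fields on $\mathcal{K}(\mathbb{M}_2)$: $V_1=(0,-2\beta,-\alpha,0,-\gamma,0)$ and $V_2=(-2\alpha,0,-\beta,-\gamma,0,0)$ (translations); $V_3=(2C,2C,A+B,\beta,\alpha,0)$ (boost); $V_4=(2A,2B,2C,\alpha,\beta,0)$ (dilatation of the plane); $V_5=(1,-1,0,0,0,0)$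 (addition of a multiple of the metric); $V_6=(A,B,C,\alpha,\beta,\gamma)$ (scalar multiplication). Discrete transformations of $\mathcal{K}(\mathbb{M}_2)$ (unlisted coordinates are unchanged): $R_0:\mathbf{K}\mapsto-\mathbf{K}$; $R_1: C\mapsto-C,\ \alpha\mapsto-\alpha$; $R_2: C\mapsto-C,\ \beta\mapsto-\beta$. $G_M$ is the group of transformations of $\mathcal{K}(\mathbb{M}_2)$ generated by the flows of $V_1,\dots,V_6$ and by $R_0,R_1,R_2$. $S_1=\{\gamma=0\}$; $S_2=\{[\gamma(A+B-2C)-(\alpha-\beta)^2]\,[\gamma(A+B+2C)-(\alpha+\beta)^2]=0\}$. *)

theory Defs
  imports "HOL-Analysis.Analysis" "HOL-Algebra.Group_Action" "HOL-Algebra.Generated_Groups"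
begin

text \<open>
  Killing 2-tensors of the Minkowski plane are identified with their parameter vectors
  \<open>(A, B, C, \<alpha>, \<beta>, \<gamma>)\<close>; \<open>killing_tensor\<close> returns the matrix of contravariant components,
  in the pseudo-Cartesian coordinates \<open>(t, x)\<close>, of the tensor field with the given parameters.
\<close>

type_synonym killing = "real \<times> real \<times> real \<times> real \<times> real \<times> real"

fun killing_tensor :: "killing \<Rightarrow> real \<times> real \<Rightarrow> real^2^2" where
  "killing_tensor (A, B, C, \<alpha>, \<beta>, \<gamma>) (t, x) =
     vector [vector [A + 2 * \<alpha> * x + \<gamma> * x\<^sup>2, C + \<alpha> * t + \<beta> * x + \<gamma> * t * x],
             vector [C + \<alpha> * t + \<beta> * x + \<gamma> * t * x, B + 2 * \<beta> * t + \<gamma> * t\<^sup>2]]"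

lemma inj_killing_tensor: "inj killing_tensor"
proof (rule injI)
  fix K L assume eq: "killing_tensor K = killing_tensor L"
  obtain A B C a b c where K: "K = (A, B, C, a, b, c)" by (metis prod.exhaust)
  obtain A' B' C' a' b' c' where L: "L = (A', B', C', a', b', c')" by (metis prod.exhaust)
  have comp: "killing_tensor K (t, x) $ i $ j = killing_tensor L (t, x) $ i $ j" for t x i j
    using eq by simp
  show "K = L"
    using comp[of 0 0 1 1] comp[of 0 0 1 2] comp[of 0 0 2 2] comp[of 0 1 1 1]
      comp[of 0 "-1" 1 1] comp[of 1 0 2 2] comp[of "-1" 0 2 2]
    by (simp add: K L vector_2)
qed


fun V1 :: "killing \<Rightarrow> killing" where
  "V1 (A, B, C, \<alpha>, \<beta>, \<gamma>) = (0, - 2 * \<beta>, - \<alpha>, 0, - \<gamma>, 0)"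

fun V2 :: "killing \<Rightarrow> killing" where
  "V2 (A, B, C, \<alpha>, \<beta>, \<gamma>) = (- 2 * \<alpha>, 0, - \<beta>, - \<gamma>, 0, 0)"

fun V3 :: "killing \<Rightarrow> killing" where
  "V3 (A, B, C, \<alpha>, \<beta>, \<gamma>) = (2 * C, 2 * C, A + B, \<beta>, \<alpha>, 0)"

fun V4 :: "killing \<Rightarrow> killing" where
  "V4 (A, B, C, \<alpha>, \<beta>, \<gamma>) = (2 * A, 2 * B, 2 * C, \<alpha>, \<beta>, 0)"

fun V5 :: "killing \<Rightarrow> killing" where
  "V5 (A, B, C, \<alpha>, \<beta>, \<gamma>) = (1, - 1, 0, 0, 0, 0)"

fun V6 :: "killing \<Rightarrow> killing" where
  "V6 (A, B, C, \<alpha>, \<beta>, \<gamma>) = (A, B, C, \<alpha>, \<beta>, \<gamma>)"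

fun R0 :: "killing \<Rightarrow> killing" where
  "R0 K = - K"

fun R1 :: "killing \<Rightarrow> killing" where
  "R1 (A, B, C, \<alpha>, \<beta>, \<gamma>) = (A, B, - C, - \<alpha>, \<beta>, \<gamma>)"

fun R2 :: "killing \<Rightarrow> killing" where
  "R2 (A, B, C, \<alpha>, \<beta>, \<gamma>) = (A, B, - C, \<alpha>, - \<beta>, \<gamma>)"

definition is_flow :: "('a::real_normed_vector \<Rightarrow> 'a) \<Rightarrow> (real \<Rightarrow> 'a \<Rightarrow> 'a) \<Rightarrow> bool" where
  "is_flow V \<phi> \<longleftrightarrow>
     (\<forall>p. \<phi> 0 p = p \<and> (\<forall>t. ((\<lambda>s. \<phi> s p) has_vector_derivative V (\<phi> t p)) (at t)))"

definition GM_generators :: "(killing \<Rightarrow> killing) set" where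
  "GM_generators =
     {\<phi> t | V \<phi> t. V \<in> {V1, V2, V3, V4, V5, V6} \<and> is_flow V \<phi>} \<union> {R0, R1, R2}"

definition GM :: "(killing \<Rightarrow> killing) monoid" where
  "GM = subgroup_generated (BijGroup UNIV) GM_generators"

definition S1 :: "killing set" where
  "S1 = {(A, B, C, \<alpha>, \<beta>, \<gamma>). \<gamma> = 0}"

definition S2 :: "killing set" where
  "S2 = {(A, B, C, \<alpha>, \<beta>, \<gamma>).
     (\<gamma> * (A + B - 2 * C) - (\<alpha> - \<beta>)\<^sup>2) * (\<gamma> * (A + B + 2 * C) - (\<alpha> + \<beta>)\<^sup>2) = 0}"


text \<open>
  \<open>subgroup_generated\<close> ignores generators outside the carrier; the following lemmas show that
  every generator is a bijection, so that none is lost, and that \<open>GM\<close> acts on the whole space.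
\<close>

lemma lipschitz_solution_unique_right:
  fixes V :: "'a::real_inner \<Rightarrow> 'a"
  assumes lip: "\<And>p q. norm (V p - V q) \<le> L * norm (p - q)"
    and u: "\<And>t. (u has_vector_derivative V (u t)) (at t)"
    and v: "\<And>t. (v has_vector_derivative V (v t)) (at t)"
    and eq: "u 0 = v 0" and "t \<ge> 0"
  shows "u t = v t"
proof -
  define g where "g s = exp (- 2 * L * s) * ((u s - v s) \<bullet> (u s - v s))" for s
  define d where
    "d s = 2 * exp (- 2 * L * s) * ((u s - v s) \<bullet> (V (u s) - V (v s)) - L * ((u s - v s) \<bullet> (u s - v s)))" for s
  have w: "((\<lambda>s. u s - v s) has_derivative (\<lambda>h. h *\<^sub>R (V (u s) - V (v s)))) (at s)" for s
    using has_vector_derivative_diff[OF u v] by (simp add: has_vector_derivative_def)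
  have g': "(g has_real_derivative d s) (at s)" for s
    unfolding has_field_derivative_def g_def[abs_def]
    by (rule derivative_eq_intros w refl | simp)+
       (simp add: d_def fun_eq_iff algebra_simps inner_commute)
  have d_le: "d s \<le> 0" for s
  proof -
    have "(u s - v s) \<bullet> (V (u s) - V (v s)) \<le> norm (u s - v s) * norm (V (u s) - V (v s))"
      by (rule norm_cauchy_schwarz)
    also have "\<dots> \<le> norm (u s - v s) * (L * norm (u s - v s))"
      by (intro mult_left_mono lip norm_ge_zero)
    also have "\<dots> = L * ((u s - v s) \<bullet> (u s - v s))"
      by (simp add: dot_square_norm power2_eq_square)
    finally show ?thesis
      unfolding d_def by (intro mult_nonneg_nonpos) auto
  qed
  have "g t \<le> g 0"
    by (rule DERIV_nonpos_imp_nonincreasing[OF \<open>t \<ge> 0\<close>]) (use g' d_le in blast)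
  then have "(u t - v t) \<bullet> (u t - v t) \<le> 0"
    by (simp add: g_def eq mult_le_0_iff)
  then have "(u t - v t) \<bullet> (u t - v t) = 0"
    using inner_ge_zero[of "u t - v t"] by linarith
  then show ?thesis
    by simp
qed

lemma lipschitz_solution_unique:
  fixes V :: "'a::real_inner \<Rightarrow> 'a"
  assumes lip: "\<And>p q. norm (V p - V q) \<le> L * norm (p - q)"
    and u: "\<And>t. (u has_vector_derivative V (u t)) (at t)"
    and v: "\<And>t. (v has_vector_derivative V (v t)) (at t)"
    and eq: "u 0 = v 0"
  shows "u t = v t"
proof (cases "t \<ge> 0")
  case True
  then show ?thesis using lipschitz_solution_unique_right[OF lip u v eq] by blast
next
  case False
  have rev: "((\<lambda>s. f (- s)) has_vector_derivative - V (f (- s))) (at s)"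
    if "\<And>t. (f has_vector_derivative V (f t)) (at t)" for f s
  proof -
    have "(uminus has_vector_derivative - 1) (at s)"
      using has_vector_derivative_minus[OF has_vector_derivative_id] by simp
    from vector_diff_chain_at[OF this that] show ?thesis by (simp add: o_def)
  qed
  have "u (- (- t)) = v (- (- t))"
    by (rule lipschitz_solution_unique_right[where V = "\<lambda>p. - V p" and L = L
          and u = "\<lambda>s. u (- s)" and v = "\<lambda>s. v (- s)" and t = "- t"])
       (use lip u v eq False rev in \<open>auto simp: norm_minus_commute\<close>)
  then show ?thesis by simp
qed

lemma lipschitz_flow_bij:
  fixes V :: "'a::real_inner \<Rightarrow> 'a"
  assumes lip: "\<And>p q. norm (V p - V q) \<le> L * norm (p - q)" and flow: "is_flow V \<phi>"
  shows "bij (\<phi> t)"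
proof -
  have add: "\<phi> s (\<phi> t p) = \<phi> (s + t) p" for s t p
  proof (rule lipschitz_solution_unique[where V = V and L = L
        and u = "\<lambda>s. \<phi> s (\<phi> t p)" and v = "\<lambda>s. \<phi> (s + t) p"])
    show "((\<lambda>s. \<phi> (s + t) p) has_vector_derivative V (\<phi> (r + t) p)) (at r)" for r
    proof -
      have "((\<lambda>s. s + t) has_vector_derivative 1) (at r)"
        by (auto intro!: derivative_eq_intros)
      moreover have "((\<lambda>s. \<phi> s p) has_vector_derivative V (\<phi> (r + t) p)) (at (r + t))"
        using flow by (simp add: is_flow_def)
      ultimately show ?thesis
        using vector_diff_chain_at[of "\<lambda>s. s + t" 1 r "\<lambda>s. \<phi> s p"] by (simp add: o_def)
    qed
  qed (use lip flow in \<open>auto simp: is_flow_def\<close>)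
  show ?thesis
    by (rule o_bij[where g = "\<phi> (- t)"]) (use flow in \<open>auto simp: fun_eq_iff add is_flow_def\<close>)
qed

lemma affine_lipschitz:
  fixes V :: "'a::euclidean_space \<Rightarrow> 'a"
  assumes "linear (\<lambda>p. V p - V 0)"
  obtains L where "\<And>p q. norm (V p - V q) \<le> L * norm (p - q)"
proof -
  obtain L where L: "\<And>p. norm (V p - V 0) \<le> L * norm p"
    using linear_bounded[OF assms] by blast
  have "V p - V q = V (p - q) - V 0" for p q
    using linear_diff[OF assms, of p q] by simp
  then show thesis using that L by metis
qed

lemma linear_V: "V \<in> {V1, V2, V3, V4, V5, V6} \<Longrightarrow> linear (\<lambda>p. V p - V 0)"
  by (auto intro!: linearI simp: zero_prod_def algebra_simps)

lemma GM_generators_subset: "GM_generators \<subseteq> carrier (BijGroup UNIV)"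
proof -
  have "bij (\<phi> t)" if "V \<in> {V1, V2, V3, V4, V5, V6}" "is_flow V \<phi>" for V \<phi> t
    using affine_lipschitz[OF linear_V[OF that(1)]] lipschitz_flow_bij[OF _ that(2)] by metis
  moreover have "bij R0" "bij R1" "bij R2"
    by (auto intro!: involuntory_imp_bij)
  ultimately show ?thesis
    by (auto simp: GM_generators_def BijGroup_def Bij_def)
qed

lemma group_action_GM: "group_action GM UNIV (\<lambda>g. g)"
proof -
  interpret B: group "BijGroup (UNIV :: killing set)" by (rule group_BijGroup)
  have "group GM"
    unfolding GM_def by (rule B.group_subgroup_generated)
  moreover have "(\<lambda>g. g) \<in> hom GM (BijGroup UNIV)"
    using B.carrier_subgroup_generated_subset by (auto simp: hom_def GM_def subgroup_generated_def)
  ultimately show ?thesis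
    by (simp add: group_action_def group_hom_def group_hom_axioms_def group_BijGroup)
qed

end

theory Submission
  imports Defs
begin

text \<open>
  On \<open>S1\<close> the equation of \<open>S2\<close> reduces to \<open>(\<alpha> - \<beta>)\<^sup>2 (\<alpha> + \<beta>)\<^sup>2 = 0\<close>, because every other term
  carries the factor \<open>\<gamma> = 0\<close>. So \<open>S1 - S2\<close> is the hyperplane \<open>\<gamma> = 0\<close> with the two hyperplanes
  \<open>\<alpha> = \<beta>\<close> and \<open>\<alpha> = - \<beta>\<close> removed, and it splits into four sectors according to the signs of
  \<open>\<alpha> - \<beta>\<close> and \<open>\<alpha> + \<beta>\<close>. Each sector is convex and relatively open, hence these are the
  components (\<open>components_S1_minus_S2\<close>), and the reflection \<open>R0\<close> in the origin flips both signs.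

  The orbits are told apart by the sign of the discriminant \<open>\<alpha>\<^sup>2 - \<beta>\<^sup>2 = (\<alpha> - \<beta>) (\<alpha> + \<beta>)\<close>. Along a flow
  of any of the six fields \<open>\<gamma>\<close> satisfies a linear equation \<open>\<gamma>' = c \<gamma>\<close>, so that \<open>\<gamma> = 0\<close> is invariant,
  and on \<open>\<gamma> = 0\<close> the discriminant \<open>D\<close> satisfies \<open>D' = k D\<close> and keeps its sign
  (\<open>flow_preserves_disc_class\<close>). \<open>R0\<close>, \<open>R1\<close> and \<open>R2\<close> leave \<open>\<alpha>\<^sup>2\<close>, \<open>\<beta>\<^sup>2\<close> and the vanishing of \<open>\<gamma>\<close>
  untouched. A set with prescribed sign of \<open>D\<close> is the union of a sector and its opposite.

  Conversely each of these two sets is a single orbit (\<open>disc_class_reaches_normal_form\<close>): after \<open>R0\<close> it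
  may be assumed that \<open>\<alpha> + \<beta> > 0\<close>. The boost multiplies \<open>\<alpha> + \<beta>\<close> by \<open>e\<^sup>t\<close> and \<open>\<alpha> - \<beta>\<close> by \<open>e\<^sup>-\<^sup>t\<close>, so it can
  make their absolute values agree, which kills \<open>\<beta>\<close> or \<open>\<alpha>\<close>. With a single nonzero entry left among
  \<open>\<alpha>, \<beta>, \<gamma>\<close>, the two translations and the metric term move \<open>(A, B, C)\<close> in three independent
  directions to \<open>(0, 0, 0)\<close>, and scalar multiplication normalises what remains.
\<close>

section \<open>Components of a space partitioned into relatively open connected pieces\<close>

text \<open>
  A member of the partition is also relatively closed, since its complement is the union of the
  others; a larger connected set would therefore contain it as a nontrivial clopen part.
\<close>

lemma components_eq_open_partition:
  assumes cover: "\<Union>F = S"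
    and disj: "\<And>T U. T \<in> F \<Longrightarrow> U \<in> F \<Longrightarrow> T \<noteq> U \<Longrightarrow> T \<inter> U = {}"
    and opn: "\<And>T. T \<in> F \<Longrightarrow> openin (top_of_set S) T"
    and con: "\<And>T. T \<in> F \<Longrightarrow> connected T"
    and ne: "\<And>T. T \<in> F \<Longrightarrow> T \<noteq> {}"
  shows "components S = F"
proof -
  have comp: "T \<in> components S" if T: "T \<in> F" for T
  proof -
    have "S - T = \<Union>(F - {T})"
      using cover disj T by blast
    then have "openin (top_of_set S) (S - T)"
      using opn by auto
    then have clo: "closedin (top_of_set S) T"
      using cover T by (auto simp: closedin_def)
    have "d = T" if d: "T \<subseteq> d" "d \<subseteq> S" "connected d" for d
    proof -
      have "openin (top_of_set d) T" "closedin (top_of_set d) T"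
        using d openin_subset_trans[OF opn[OF T]] closedin_subset_trans[OF clo] by auto
      with d ne[OF T] show ?thesis
        unfolding connected_clopen by blast
    qed
    then show ?thesis
      using cover T con[OF T] ne[OF T] unfolding in_components_maximal by blast
  qed
  have "C \<in> F" if C: "C \<in> components S" for C
  proof -
    obtain x where x: "x \<in> C" "x \<in> S"
      using in_components_nonempty[OF C] in_components_subset[OF C] by blast
    then obtain T where "T \<in> F" "x \<in> T"
      using cover by blast
    with x components_nonoverlap[OF C comp] show ?thesis by blast
  qed
  with comp show ?thesis by blast
qed

section \<open>The four sectors\<close>

definition sector :: "real \<Rightarrow> real \<Rightarrow> killing set" where
  "sector \<sigma> \<tau> = {(A, B, C, \<alpha>, \<beta>, \<gamma>). \<gamma> = 0 \<and> sgn (\<alpha> - \<beta>) = \<sigma> \<and> sgn (\<alpha> + \<beta>) = \<tau>}"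

abbreviation signs :: "real set" where
  "signs \<equiv> {1, -1}"

text \<open>
  Unlike the equations between signs, these inequalities are visibly open and convex conditions.
\<close>

lemma mem_sector:
  assumes "\<sigma> \<in> signs" "\<tau> \<in> signs"
  shows "(A, B, C, a, b, g) \<in> sector \<sigma> \<tau> \<longleftrightarrow> g = 0 \<and> \<sigma> * (a - b) > 0 \<and> \<tau> * (a + b) > 0"
  using assms by (auto simp: sector_def sgn_if)

text \<open>With \<open>\<gamma> = 0\<close> the polynomial that defines \<open>S2\<close> is \<open>(\<alpha> - \<beta>)\<^sup>2 (\<alpha> + \<beta>)\<^sup>2\<close>.\<close>

lemma S1_minus_S2_iff: "(A, B, C, a, b, g) \<in> S1 - S2 \<longleftrightarrow> g = 0 \<and> a - b \<noteq> 0 \<and> a + b \<noteq> 0"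
  by (auto simp: S1_def S2_def)

lemma sgn_in_signs: "(x :: real) \<noteq> 0 \<Longrightarrow> sgn x \<in> signs"
  by (auto simp: sgn_if)

lemma Union_sectors: "\<Union>{sector \<sigma> \<tau> | \<sigma> \<tau>. \<sigma> \<in> signs \<and> \<tau> \<in> signs} = S1 - S2" (is "\<Union>?F = _")
proof (rule Set.set_eqI)
  fix K :: killing
  obtain A B C a b g where K: "K = (A, B, C, a, b, g)" by (metis prod.exhaust)
  show "K \<in> \<Union>?F \<longleftrightarrow> K \<in> S1 - S2"
  proof
    assume "K \<in> \<Union>?F"
    then obtain \<sigma> \<tau> where "\<sigma> \<in> signs" "\<tau> \<in> signs" "K \<in> sector \<sigma> \<tau>" by blast
    then show "K \<in> S1 - S2"
      unfolding K S1_minus_S2_iff by (auto simp: sector_def sgn_if split: if_splits)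
  next
    assume "K \<in> S1 - S2"
    then have "g = 0" "a - b \<noteq> 0" "a + b \<noteq> 0"
      unfolding K S1_minus_S2_iff by auto
    then have "K \<in> sector (sgn (a - b)) (sgn (a + b))" "sgn (a - b) \<in> signs" "sgn (a + b) \<in> signs"
      by (auto simp: K sector_def intro!: sgn_in_signs simp del: insert_iff)
    then show "K \<in> \<Union>?F" by blast
  qed
qed

lemma sector_nonempty:
  assumes "\<sigma> \<in> signs" "\<tau> \<in> signs"
  shows "sector \<sigma> \<tau> \<noteq> {}"
proof -
  \<comment> \<open>the solution of \<open>\<alpha> - \<beta> = \<sigma>\<close>, \<open>\<alpha> + \<beta> = \<tau>\<close>\<close>
  have "(0, 0, 0, (\<sigma> + \<tau>) / 2, (\<tau> - \<sigma>) / 2, 0) \<in> sector \<sigma> \<tau>"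
    using assms by (auto simp: mem_sector)
  then show ?thesis by blast
qed

lemma sector_disjoint:
  "K \<in> sector \<sigma> \<tau> \<Longrightarrow> K \<in> sector \<sigma>' \<tau>' \<Longrightarrow> \<sigma> = \<sigma>' \<and> \<tau> = \<tau>'"
  by (auto simp: sector_def)

lemma sector_eq_iff:
  assumes "\<sigma> \<in> signs" "\<tau> \<in> signs"
  shows "sector \<sigma> \<tau> = sector \<sigma>' \<tau>' \<longleftrightarrow> \<sigma> = \<sigma>' \<and> \<tau> = \<tau>'"
  using sector_nonempty[OF assms] sector_disjoint by blast

lemma connected_sector:
  assumes "\<sigma> \<in> signs" "\<tau> \<in> signs"
  shows "connected (sector \<sigma> \<tau>)"
proof (rule convex_connected, rule convexI)
  fix K L :: killing and u v :: real
  assume KL: "K \<in> sector \<sigma> \<tau>" "L \<in> sector \<sigma> \<tau>" and uv: "0 \<le> u" "0 \<le> v" "u + v = 1"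
  obtain A B C a b g where K: "K = (A, B, C, a, b, g)" by (metis prod.exhaust)
  obtain A' B' C' a' b' g' where L: "L = (A', B', C', a', b', g')" by (metis prod.exhaust)
  have pos: "u * x + v * y > 0" if "x > 0" "y > 0" for x y
  proof (cases "u = 0")
    case False
    then have "u * x > 0" using uv that by simp
    then show ?thesis using uv that by (simp add: add_pos_nonneg)
  qed (use uv that in simp)
  have "\<sigma> * (u * a + v * a' - (u * b + v * b')) = u * (\<sigma> * (a - b)) + v * (\<sigma> * (a' - b'))"
    and "\<tau> * (u * a + v * a' + (u * b + v * b')) = u * (\<tau> * (a + b)) + v * (\<tau> * (a' + b'))"
    by (simp_all add: algebra_simps)
  with KL pos show "u *\<^sub>R K + v *\<^sub>R L \<in> sector \<sigma> \<tau>"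
    by (simp add: K L mem_sector[OF assms])
qed

lemma openin_sector:
  assumes "\<sigma> \<in> signs" "\<tau> \<in> signs"
  shows "openin (top_of_set (S1 - S2)) (sector \<sigma> \<tau>)"
proof -
  define U :: "killing set" where
    "U = {K. 0 < \<sigma> * (fst (snd (snd (snd K))) - fst (snd (snd (snd (snd K)))))} \<inter>
         {K. 0 < \<tau> * (fst (snd (snd (snd K))) + fst (snd (snd (snd (snd K)))))}"
  have "open U"
    unfolding U_def by (intro open_Int open_Collect_less continuous_intros)
  moreover have "sector \<sigma> \<tau> = (S1 - S2) \<inter> U"
  proof (rule Set.set_eqI)
    fix K :: killing
    obtain A B C a b g where K: "K = (A, B, C, a, b, g)" by (metis prod.exhaust)
    show "K \<in> sector \<sigma> \<tau> \<longleftrightarrow> K \<in> (S1 - S2) \<inter> U"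
      unfolding K Int_iff S1_minus_S2_iff mem_sector[OF assms] by (auto simp: U_def)
  qed
  ultimately show ?thesis
    by (auto simp: openin_open)
qed

lemma components_S1_minus_S2:
  "components (S1 - S2) = {sector \<sigma> \<tau> | \<sigma> \<tau>. \<sigma> \<in> signs \<and> \<tau> \<in> signs}"
proof (rule components_eq_open_partition[OF Union_sectors])
  fix T U
  assume "T \<in> {sector \<sigma> \<tau> | \<sigma> \<tau>. \<sigma> \<in> signs \<and> \<tau> \<in> signs}"
    "U \<in> {sector \<sigma> \<tau> | \<sigma> \<tau>. \<sigma> \<in> signs \<and> \<tau> \<in> signs}" "T \<noteq> U"
  then show "T \<inter> U = {}"
    by clarsimp (metis sector_disjoint disjoint_iff)
qed (use openin_sector connected_sector sector_nonempty in blast)+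

lemma uminus_sector: "uminus ` sector \<sigma> \<tau> = sector (- \<sigma>) (- \<tau>)"
proof -
  have neg: "- K \<in> sector (- s) (- t)" if "K \<in> sector s t" for K s t
  proof -
    obtain A B C a b g where K: "K = (A, B, C, a, b, g)" by (metis prod.exhaust)
    have "- a + b = - (a - b)" "- a - b = - (a + b)" by simp_all
    then have "sgn (- a - - b) = - sgn (a - b)" "sgn (- a + - b) = - sgn (a + b)"
      by (simp_all only: sgn_minus diff_minus_eq_add add_uminus_conv_diff)
    then show ?thesis
      using that by (simp only: K sector_def mem_Collect_eq prod.case uminus_Pair) simp
  qed
  have "K \<in> uminus ` sector \<sigma> \<tau>" if "K \<in> sector (- \<sigma>) (- \<tau>)" for K
    using neg[OF that] by (intro image_eqI[of _ _ "- K"]) auto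
  with neg show ?thesis by blast
qed

section \<open>The sign of the discriminant as an invariant of the group\<close>

definition disc_class :: "real \<Rightarrow> killing set" where
  "disc_class s = {(A, B, C, \<alpha>, \<beta>, \<gamma>). \<gamma> = 0 \<and> sgn (\<alpha>\<^sup>2 - \<beta>\<^sup>2) = s}"

text \<open>The discriminant factors as \<open>(\<alpha> - \<beta>) (\<alpha> + \<beta>)\<close>, so its sign is the product of the two signs.\<close>

lemma disc_class_eq_sectors:
  assumes "s \<in> signs"
  shows "disc_class s = sector 1 s \<union> sector (- 1) (- s)"
proof (rule Set.set_eqI)
  fix K :: killing
  obtain A B C a b g where K: "K = (A, B, C, a, b, g)" by (metis prod.exhaust)
  have "a\<^sup>2 - b\<^sup>2 = (a - b) * (a + b)"
    by (simp add: power2_eq_square algebra_simps)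
  then have "sgn (a\<^sup>2 - b\<^sup>2) = sgn (a - b) * sgn (a + b)"
    by (simp add: sgn_mult)
  then show "K \<in> disc_class s \<longleftrightarrow> K \<in> sector 1 s \<union> sector (- 1) (- s)"
    using assms by (auto simp: K disc_class_def sector_def sgn_if split: if_splits)
qed

text \<open>The product of \<open>f\<close> with the integrating factor \<open>e\<^sup>-\<^sup>c\<^sup>t\<close> has derivative zero.\<close>

lemma linear_ode_unique:
  fixes f :: "real \<Rightarrow> real"
  assumes "\<And>t. (f has_real_derivative c * f t) (at t)"
  shows "f t = exp (c * t) * f 0"
proof -
  have "((\<lambda>t. exp (- c * t) * f t) has_real_derivative 0) (at t)" for t
    by (rule derivative_eq_intros assms refl | simp)+
  then have "exp (- c * t) * f t = exp (- c * 0) * f 0"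
    using DERIV_isconst_all by blast
  then show ?thesis
    by (simp add: exp_minus field_simps)
qed

text \<open>
  The argument applies to any flow, without its closed form: \<open>\<gamma>\<close> and, once \<open>\<gamma>\<close> vanishes, also \<open>\<alpha>\<^sup>2 - \<beta>\<^sup>2\<close> solve scalar linear
  equations along it, and the solutions of these change only by positive factors. The condition
  \<open>\<gamma> = 0\<close> matters for the translations, which act on \<open>\<alpha>\<close> and \<open>\<beta>\<close> by multiples of \<open>\<gamma>\<close>.
\<close>

lemma flow_preserves_disc_class:
  assumes V: "V \<in> {V1, V2, V3, V4, V5, V6}" and flow: "is_flow V \<phi>"
  shows "\<phi> t K \<in> disc_class s \<longleftrightarrow> K \<in> disc_class s"
proof -
  define a where "a t = fst (snd (snd (snd (\<phi> t K))))" for t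
  define b where "b t = fst (snd (snd (snd (snd (\<phi> t K)))))" for t
  define g where "g t = snd (snd (snd (snd (snd (\<phi> t K)))))" for t
  have \<phi>: "((\<lambda>t. \<phi> t K) has_vector_derivative V (\<phi> t K)) (at t)" for t
    using flow unfolding is_flow_def by blast
  have blin: "bounded_linear (\<lambda>K :: killing. fst (snd (snd (snd K))))"
    "bounded_linear (\<lambda>K :: killing. fst (snd (snd (snd (snd K)))))"
    "bounded_linear (\<lambda>K :: killing. snd (snd (snd (snd (snd K)))))"
    by (intro bounded_linear_intros)+
  have a': "(a has_real_derivative fst (snd (snd (snd (V (\<phi> t K)))))) (at t)"
    and b': "(b has_real_derivative fst (snd (snd (snd (snd (V (\<phi> t K))))))) (at t)"
    and g': "(g has_real_derivative snd (snd (snd (snd (snd (V (\<phi> t K))))))) (at t)" for t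
    using blin[THEN bounded_linear.has_vector_derivative, OF \<phi>]
    by (simp_all add: a_def[abs_def] b_def[abs_def] g_def[abs_def]
        has_real_derivative_iff_has_vector_derivative)
  have split: "\<exists>A B C. \<phi> t K = (A, B, C, a t, b t, g t)" for t
    by (metis a_def b_def g_def prod.collapse)
  \<comment> \<open>\<open>\<gamma>\<close> grows with rate 1 under scalar multiplication and is constant under the other flows\<close>
  obtain c where "\<And>t. (g has_real_derivative c * g t) (at t)"
  proof (cases "V = V6")
    case True
    show ?thesis
      by (rule that[of 1]) (use g' split True in \<open>metis V6.simps mult_1 snd_conv\<close>)
  next
    case False
    have "snd (snd (snd (snd (snd (V (\<phi> t K)))))) = 0" for t
      using split[of t] V False by auto
    then show ?thesis
      using g' by (intro that[of 0]) (metis mult_zero_left)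
  qed
  then have g: "g t = exp (c * t) * g 0" for t
    by (rule linear_ode_unique)
  have disc: "sgn ((a t)\<^sup>2 - (b t)\<^sup>2) = sgn ((a 0)\<^sup>2 - (b 0)\<^sup>2)" if g0: "g 0 = 0"
  proof -
    define D where "D t = (a t)\<^sup>2 - (b t)\<^sup>2" for t
    have D': "(D has_real_derivative 2 * a t * fst (snd (snd (snd (V (\<phi> t K)))))
        - 2 * b t * fst (snd (snd (snd (snd (V (\<phi> t K))))))) (at t)" for t
      unfolding D_def[abs_def] by (rule derivative_eq_intros a' b' refl | simp)+
    have g_zero: "g t = 0" for t
      using g[of t] g0 by simp
    \<comment> \<open>both dilatations scale \<open>\<alpha>\<close> and \<open>\<beta>\<close> with rate 1, hence \<open>D\<close> with rate 2; the boost is an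
      isometry of the quadratic form \<open>D\<close>, and the other flows fix \<open>\<alpha>\<close> and \<open>\<beta>\<close> when \<open>\<gamma> = 0\<close>\<close>
    obtain k where "\<And>t. (D has_real_derivative k * D t) (at t)"
    proof (cases "V \<in> {V4, V6}")
      case True
      have "2 * a t * fst (snd (snd (snd (V (\<phi> t K)))))
          - 2 * b t * fst (snd (snd (snd (snd (V (\<phi> t K)))))) = 2 * D t" for t
        using split[of t] True by (auto simp: D_def power2_eq_square)
      then show ?thesis using D' by (intro that[of 2]) metis
    next
      case False
      have "2 * a t * fst (snd (snd (snd (V (\<phi> t K)))))
          - 2 * b t * fst (snd (snd (snd (snd (V (\<phi> t K)))))) = 0" for t
        using split[of t] V False g_zero[of t] by auto
      then show ?thesis using D' by (intro that[of 0]) (metis mult_zero_left)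
    qed
    then have "D t = exp (k * t) * D 0"
      by (rule linear_ode_unique)
    then show ?thesis
      by (simp add: D_def[symmetric] sgn_mult)
  qed
  have mem: "\<phi> t K \<in> disc_class s \<longleftrightarrow> g t = 0 \<and> sgn ((a t)\<^sup>2 - (b t)\<^sup>2) = s" for t
    using split[of t] by (auto simp: disc_class_def)
  have "\<phi> 0 K = K"
    using flow unfolding is_flow_def by blast
  with mem[of 0] mem[of t] g[of t] disc show ?thesis
    by auto
qed

lemma generator_preserves_disc_class:
  assumes "h \<in> GM_generators"
  shows "h K \<in> disc_class s \<longleftrightarrow> K \<in> disc_class s"
proof -
  have "R K \<in> disc_class s \<longleftrightarrow> K \<in> disc_class s" if "R \<in> {R0, R1, R2}" for R
    using that by (cases K) (auto simp: disc_class_def)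
  with assms flow_preserves_disc_class show ?thesis
    unfolding GM_generators_def by blast
qed

text \<open>
  Stating the invariance as an equivalence makes it pass to inverses of generators as well as
  to products.
\<close>

lemma GM_preserves_disc_class:
  assumes "h \<in> carrier GM"
  shows "h K \<in> disc_class s \<longleftrightarrow> K \<in> disc_class s"
proof -
  have gen: "carrier (BijGroup UNIV) \<inter> GM_generators = GM_generators"
    using GM_generators_subset by blast
  have Bij: "h \<in> Bij UNIV" if "h \<in> generate (BijGroup UNIV) GM_generators" for h
    using group.generate_in_carrier[OF group_BijGroup GM_generators_subset that]
    by (simp add: BijGroup_def)
  have "h \<in> generate (BijGroup UNIV) GM_generators"
    using assms by (simp add: GM_def carrier_subgroup_generated gen)
  then show ?thesis
  proof (induction arbitrary: K rule: generate.induct)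
    case one
    then show ?case by (simp add: BijGroup_def)
  next
    case (incl h)
    then show ?case by (rule generator_preserves_disc_class)
  next
    case (inv h)
    then have h: "h \<in> Bij UNIV"
      by (intro Bij generate.incl)
    then have "h (inv_into UNIV h K) = K"
      by (simp add: Bij_def bij_is_surj surj_f_inv_f)
    with generator_preserves_disc_class[OF inv] inv_BijGroup[OF h] show ?case
      by (metis UNIV_I restrict_apply')
  next
    case (eng h1 h2)
    then show ?case
      using Bij[OF eng.hyps(1)] Bij[OF eng.hyps(2)] by (simp add: BijGroup_def compose_def)
  qed
qed

section \<open>Explicit flows\<close>

text \<open>
  The generators are flows on the whole space, so the formulas must hold for \<open>\<gamma> \<noteq> 0\<close> too, although
  they will be applied only at \<open>\<gamma> = 0\<close>.
\<close>

fun flow1 :: "real \<Rightarrow> killing \<Rightarrow> killing" where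
  "flow1 t (A, B, C, \<alpha>, \<beta>, \<gamma>) = (A, B - 2 * \<beta> * t + \<gamma> * t\<^sup>2, C - \<alpha> * t, \<alpha>, \<beta> - \<gamma> * t, \<gamma>)"

fun flow2 :: "real \<Rightarrow> killing \<Rightarrow> killing" where
  "flow2 t (A, B, C, \<alpha>, \<beta>, \<gamma>) = (A - 2 * \<alpha> * t + \<gamma> * t\<^sup>2, B, C - \<beta> * t, \<alpha> - \<gamma> * t, \<beta>, \<gamma>)"

text \<open>
  The boost acts on the vector \<open>(\<alpha>, \<beta>)\<close> with rapidity \<open>t\<close>; the quadratic part has rapidity \<open>2 t\<close>, rotating
  \<open>(A + B) / 2\<close> and \<open>C\<close> hyperbolically into each other while \<open>A - B\<close> stays constant.
\<close>

fun flow3 :: "real \<Rightarrow> killing \<Rightarrow> killing" where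
  "flow3 t (A, B, C, \<alpha>, \<beta>, \<gamma>) =
    ((A - B) / 2 + (A + B) / 2 * cosh (2 * t) + C * sinh (2 * t),
     (B - A) / 2 + (A + B) / 2 * cosh (2 * t) + C * sinh (2 * t),
     C * cosh (2 * t) + (A + B) / 2 * sinh (2 * t),
     \<alpha> * cosh t + \<beta> * sinh t, \<beta> * cosh t + \<alpha> * sinh t, \<gamma>)"

fun flow5 :: "real \<Rightarrow> killing \<Rightarrow> killing" where
  "flow5 t (A, B, C, \<alpha>, \<beta>, \<gamma>) = (A + t, B - t, C, \<alpha>, \<beta>, \<gamma>)"

definition flow6 :: "real \<Rightarrow> killing \<Rightarrow> killing" where
  "flow6 t K = exp t *\<^sub>R K"

lemma is_flow_flow1: "is_flow V1 flow1"
  unfolding is_flow_def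
  by (clarsimp split: prod.splits)
     (auto intro!: has_vector_derivative_Pair derivative_eq_intros
       simp: zero_prod_def has_real_derivative_iff_has_vector_derivative[symmetric])

lemma is_flow_flow2: "is_flow V2 flow2"
  unfolding is_flow_def
  by (clarsimp split: prod.splits)
     (auto intro!: has_vector_derivative_Pair derivative_eq_intros
       simp: zero_prod_def has_real_derivative_iff_has_vector_derivative[symmetric])

lemma is_flow_flow3: "is_flow V3 flow3"
  unfolding is_flow_def
  by (clarsimp split: prod.splits)
     (auto intro!: has_vector_derivative_Pair derivative_eq_intros
       simp: zero_prod_def has_real_derivative_iff_has_vector_derivative[symmetric] field_simps)

lemma is_flow_flow5: "is_flow V5 flow5"
  unfolding is_flow_def
  by (clarsimp split: prod.splits)
     (auto intro!: has_vector_derivative_Pair derivative_eq_intros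
       simp: zero_prod_def has_real_derivative_iff_has_vector_derivative[symmetric])

lemma is_flow_flow6: "is_flow V6 flow6"
  unfolding is_flow_def
  by (clarsimp simp: flow6_def)
     (auto intro!: has_vector_derivative_Pair derivative_eq_intros
       simp: zero_prod_def has_real_derivative_iff_has_vector_derivative[symmetric])

section \<open>Transitivity on each sign class\<close>

definition reaches :: "killing \<Rightarrow> killing \<Rightarrow> bool" where
  "reaches K L \<longleftrightarrow> L \<in> orbit GM (\<lambda>g. g) K"

lemma reaches_sym: "reaches K L \<Longrightarrow> reaches L K"
  using group_action.orbit_sym[OF group_action_GM] by (simp add: reaches_def)

lemma reaches_trans [trans]: "reaches K L \<Longrightarrow> reaches L M \<Longrightarrow> reaches K M"
  using group_action.orbit_trans[OF group_action_GM] unfolding reaches_def by blast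

lemma reaches_generator:
  assumes "h \<in> GM_generators"
  shows "reaches K (h K)"
proof -
  have "h \<in> carrier GM"
    using assms group.subgroup_generated_subset_carrier_subset[OF group_BijGroup GM_generators_subset]
    by (auto simp: GM_def)
  then show ?thesis
    by (auto simp: reaches_def orbit_def)
qed

lemma reaches_is_flow:
  assumes "V \<in> {V1, V2, V3, V4, V5, V6}" "is_flow V \<phi>"
  shows "reaches K (\<phi> t K)"
  by (rule reaches_generator) (use assms in \<open>unfold GM_generators_def, blast\<close>)

lemma reaches_flow:
  "reaches K (flow1 t K)" "reaches K (flow2 t K)" "reaches K (flow3 t K)"
  "reaches K (flow5 t K)" "reaches K (flow6 t K)"
  by (rule reaches_is_flow, (rule insertI1 insertI2)+,
      rule is_flow_flow1 is_flow_flow2 is_flow_flow3 is_flow_flow5 is_flow_flow6)+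

lemma reaches_neg: "reaches K (- K)"
  using reaches_generator[of R0] by (simp add: GM_generators_def)

text \<open>
  In the light-cone combinations \<open>\<alpha> + \<beta>\<close> and \<open>\<alpha> - \<beta>\<close> the boost with parameter \<open>ln r\<close> is diagonal,
  with factors \<open>r\<close> and \<open>1 / r\<close>. What it does to \<open>(A, B, C)\<close> is irrelevant, since these entries are
  moved to zero afterwards.
\<close>

lemma reaches_boost:
  assumes "r > 0"
  obtains A' B' C' where
    "reaches (A, B, C, a, b, 0)
      (A', B', C', ((a + b) * r + (a - b) / r) / 2, ((a + b) * r - (a - b) / r) / 2, 0)"
proof -
  have hyp: "cosh (ln r) = (r + 1 / r) / 2" "sinh (ln r) = (r - 1 / r) / 2"
    using assms by (simp_all add: cosh_ln_real sinh_ln_real inverse_eq_divide)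
  have eq: "a * cosh (ln r) + b * sinh (ln r) = ((a + b) * r + (a - b) / r) / 2"
    "b * cosh (ln r) + a * sinh (ln r) = ((a + b) * r - (a - b) / r) / 2"
    unfolding hyp by (simp_all add: algebra_simps add_divide_distrib diff_divide_distrib)
  show thesis
    using reaches_flow(3)[of "(A, B, C, a, b, 0)" "ln r"] that unfolding flow3.simps eq by blast
qed

lemma reaches_scale:
  assumes "c > 0"
  shows "reaches K (c *\<^sub>R K)"
  using reaches_flow(5)[of K "ln c"] assms by (simp add: flow6_def)

text \<open>
  For \<open>\<beta> = \<gamma> = 0\<close> the translation along \<open>V1\<close> moves only \<open>C\<close> and that along \<open>V2\<close> only \<open>A\<close>, so \<open>B\<close> has to
  be removed by the metric term, at the expense of \<open>A\<close>, before \<open>A\<close> is. For \<open>\<alpha> = \<gamma> = 0\<close> the roles of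
  \<open>A\<close> and \<open>B\<close>, and of the two translations, are exchanged.
\<close>

lemma reaches_normal_form_pos:
  assumes "a > 0"
  shows "reaches (A, B, C, a, 0, 0) (0, 0, 0, 1, 0, 0)"
proof -
  have "reaches (A, B, C, a, 0, 0) (A + B, 0, C, a, 0, 0)"
    using reaches_flow(4)[of "(A, B, C, a, 0, 0)" B] by simp
  also have "reaches \<dots> (0, 0, C, a, 0, 0)"
    using reaches_flow(2)[of "(A + B, 0, C, a, 0, 0)" "(A + B) / (2 * a)"] assms by simp
  also have "reaches \<dots> (0, 0, 0, a, 0, 0)"
    using reaches_flow(1)[of "(0, 0, C, a, 0, 0)" "C / a"] assms by simp
  also have "reaches \<dots> (0, 0, 0, 1, 0, 0)"
    using reaches_scale[of "1 / a" "(0, 0, 0, a, 0, 0)"] assms by simp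
  finally show ?thesis .
qed

lemma reaches_normal_form_neg:
  assumes "b > 0"
  shows "reaches (A, B, C, 0, b, 0) (0, 0, 0, 0, 1, 0)"
proof -
  have "reaches (A, B, C, 0, b, 0) (0, B + A, C, 0, b, 0)"
    using reaches_flow(4)[of "(A, B, C, 0, b, 0)" "- A"] by simp
  also have "reaches \<dots> (0, 0, C, 0, b, 0)"
    using reaches_flow(1)[of "(0, B + A, C, 0, b, 0)" "(B + A) / (2 * b)"] assms by simp
  also have "reaches \<dots> (0, 0, 0, 0, b, 0)"
    using reaches_flow(2)[of "(0, 0, C, 0, b, 0)" "C / b"] assms by simp
  also have "reaches \<dots> (0, 0, 0, 0, 1, 0)"
    using reaches_scale[of "1 / b" "(0, 0, 0, 0, b, 0)"] assms by simp
  finally show ?thesis .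
qed

text \<open>Encodes \<open>(0, 0, 0, 1, 0, 0)\<close> for \<open>s = 1\<close> and \<open>(0, 0, 0, 0, 1, 0)\<close> for \<open>s = - 1\<close>.\<close>

definition normal_form :: "real \<Rightarrow> killing" where
  "normal_form s = (0, 0, 0, (1 + s) / 2, (1 - s) / 2, 0)"

lemma sector_reaches_normal_form:
  assumes s: "s \<in> signs" and K: "K \<in> sector s 1"
  shows "reaches K (normal_form s)"
proof -
  obtain A B C a b where K_eq: "K = (A, B, C, a, b, 0)"
    and pos: "s * (a - b) > 0" "a + b > 0"
    using K s by (cases K) (auto simp: mem_sector)
  \<comment> \<open>the boost factor with \<open>(\<alpha> + \<beta>) r = \<bar>\<alpha> - \<beta>\<bar> / r\<close>\<close>
  define r where "r = sqrt (s * (a - b) / (a + b))"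
  have r: "r > 0"
    using pos by (simp add: r_def)
  have "r\<^sup>2 = s * (a - b) / (a + b)"
    using pos by (simp add: r_def)
  then have "(a + b) * r\<^sup>2 = s * (a - b)"
    using pos by simp
  then have "(a - b) = s * ((a + b) * r\<^sup>2)"
    using s by auto
  then have quot: "(a - b) / r = s * ((a + b) * r)"
    using r by (simp add: power2_eq_square)
  obtain A' B' C' where boost: "reaches K (A', B', C',
      ((a + b) * r + (a - b) / r) / 2, ((a + b) * r - (a - b) / r) / 2, 0)"
    using reaches_boost[OF r] unfolding K_eq by metis
  have ab: "(a + b) * r > 0"
    using pos r by simp
  show ?thesis
  proof (cases "s = 1")
    case True
    then have "reaches K (A', B', C', (a + b) * r, 0, 0)"
      using boost unfolding quot by (simp add: mult.commute)
    then show ?thesis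
      using reaches_trans reaches_normal_form_pos[OF ab] True by (auto simp: normal_form_def)
  next
    case False
    then have s: "s = - 1" using s by simp
    then have "reaches K (A', B', C', 0, (a + b) * r, 0)"
      using boost unfolding quot by (simp add: mult.commute)
    then show ?thesis
      using reaches_trans reaches_normal_form_neg[OF ab] s by (auto simp: normal_form_def)
  qed
qed

text \<open>
  The sign class consists of the sector treated above and its opposite, which \<open>R0\<close> maps onto it.
\<close>

lemma disc_class_reaches_normal_form:
  assumes s: "s \<in> signs" and K: "K \<in> disc_class s"
  shows "reaches K (normal_form s)"
proof -
  have "K \<in> sector s 1 \<or> - K \<in> sector s 1"
    using K s uminus_sector[of s 1] uminus_sector[of "- s" "- 1"]
    unfolding disc_class_eq_sectors[OF s] by force
  then show ?thesis
    using sector_reaches_normal_form[OF s] reaches_neg reaches_trans by blast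
qed

lemma orbit_eq_disc_class:
  assumes s: "s \<in> signs" and K: "K \<in> disc_class s"
  shows "orbit GM (\<lambda>g. g) K = disc_class s"
proof
  show "orbit GM (\<lambda>g. g) K \<subseteq> disc_class s"
    using GM_preserves_disc_class K unfolding orbit_def by blast
  show "disc_class s \<subseteq> orbit GM (\<lambda>g. g) K"
    using disc_class_reaches_normal_form[OF s] K reaches_sym reaches_trans
    unfolding reaches_def by blast
qed

lemma S1_minus_S2_eq_disc_classes: "S1 - S2 = disc_class 1 \<union> disc_class (- 1)"
  unfolding Union_sectors[symmetric] by (auto simp: disc_class_eq_sectors)

lemma orbits_S1_minus_S2:
  "{orb \<in> orbits GM UNIV (\<lambda>g. g). orb \<inter> (S1 - S2) \<noteq> {}} = {disc_class 1, disc_class (- 1)}"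
  (is "?O = _")
proof
  show "?O \<subseteq> {disc_class 1, disc_class (- 1)}"
  proof
    fix orb assume "orb \<in> ?O"
    then obtain K L where orb: "orb = orbit GM (\<lambda>g. g) K" and L: "L \<in> orb" "L \<in> S1 - S2"
      unfolding orbits_def by blast
    then obtain s where s: "s \<in> signs" "L \<in> disc_class s"
      unfolding S1_minus_S2_eq_disc_classes by blast
    moreover have "K \<in> disc_class s"
      using s L(1) GM_preserves_disc_class unfolding orb orbit_def by blast
    ultimately show "orb \<in> {disc_class 1, disc_class (- 1)}"
      using orbit_eq_disc_class orb by blast
  qed
  show "{disc_class 1, disc_class (- 1)} \<subseteq> ?O"
  proof -
    have "disc_class s \<in> ?O" if s: "s \<in> signs" for s
    proof -
      obtain K where K: "K \<in> disc_class s"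
        using sector_nonempty[of 1 s] s disc_class_eq_sectors[OF s] by blast
      have "disc_class s \<in> orbits GM UNIV (\<lambda>g. g)"
        using orbit_eq_disc_class[OF s K, symmetric] unfolding orbits_def by blast
      moreover have "K \<in> S1 - S2"
        using K s unfolding S1_minus_S2_eq_disc_classes by blast
      ultimately show ?thesis using K by blast
    qed
    then show ?thesis by simp
  qed
qed

section \<open>Components and orbits of the complement\<close>

theorem proposition23:
  shows "card (components (S1 - S2)) = 4
    \<and> (\<forall>D \<in> components (S1 - S2).
          uminus ` D \<in> components (S1 - S2) \<and> uminus ` D \<noteq> D \<and> R0 ` D = uminus ` D)
    \<and> card {orb \<in> orbits GM UNIV (\<lambda>g. g). orb \<inter> (S1 - S2) \<noteq> {}} = 2
    \<and> {orb \<in> orbits GM UNIV (\<lambda>g. g). orb \<inter> (S1 - S2) \<noteq> {}}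
        = {D \<union> uminus ` D | D. D \<in> components (S1 - S2)}"
proof (intro conjI ballI)
  have "components (S1 - S2) = (\<lambda>(\<sigma>, \<tau>). sector \<sigma> \<tau>) ` (signs \<times> signs)"
    unfolding components_S1_minus_S2 by blast
  moreover have "inj_on (\<lambda>(\<sigma>, \<tau>). sector \<sigma> \<tau>) (signs \<times> signs)"
    by (rule inj_onI) (use sector_eq_iff in \<open>fastforce split: prod.splits\<close>)
  ultimately show "card (components (S1 - S2)) = 4"
    by (simp add: card_image card_cartesian_product del: insert_Times_insert)
next
  fix D assume "D \<in> components (S1 - S2)"
  then obtain \<sigma> \<tau> where D: "D = sector \<sigma> \<tau>" and st: "\<sigma> \<in> signs" "\<tau> \<in> signs"
    unfolding components_S1_minus_S2 by blast
  have neg: "- \<sigma> \<in> signs" "- \<tau> \<in> signs"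
    using st by auto
  show "uminus ` D \<in> components (S1 - S2)"
    using neg unfolding D uminus_sector components_S1_minus_S2 by blast
  show "uminus ` D \<noteq> D"
    using sector_eq_iff[OF neg] st unfolding D uminus_sector by auto
  show "R0 ` D = uminus ` D"
    by auto
next
  have "sector 1 1 \<subseteq> disc_class 1" "sector 1 1 \<inter> disc_class (- 1) = {}"
    by (auto simp: disc_class_eq_sectors dest: sector_disjoint)
  then have "disc_class 1 \<noteq> disc_class (- 1)"
    using sector_nonempty[of 1 1] by auto
  then show "card {orb \<in> orbits GM UNIV (\<lambda>g. g). orb \<inter> (S1 - S2) \<noteq> {}} = 2"
    unfolding orbits_S1_minus_S2 by simp
next
  have "components (S1 - S2) = {sector 1 1, sector (- 1) (- 1), sector 1 (- 1), sector (- 1) 1}"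
    unfolding components_S1_minus_S2 by blast
  then have "{D \<union> uminus ` D | D. D \<in> components (S1 - S2)} = (\<lambda>D. D \<union> uminus ` D) `
      {sector 1 1, sector (- 1) (- 1), sector 1 (- 1), sector (- 1) 1}"
    by (simp only:) blast
  also have "\<dots> = {disc_class 1, disc_class (- 1)}"
    by (simp add: uminus_sector disc_class_eq_sectors Un_commute insert_commute)
  finally show "{orb \<in> orbits GM UNIV (\<lambda>g. g). orb \<inter> (S1 - S2) \<noteq> {}}
      = {D \<union> uminus ` D | D. D \<in> components (S1 - S2)}"
    unfolding orbits_S1_minus_S2 by simp
qed

end
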